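(* Let $S:\mathbb{R}\to\mathbb{R}$ be a function for which there exist $a\in(0,\infty)$ and a finite subset $P\subset(0,a)$ such that: (S1) $S(-x)=-S(x)$ and $S(a+x)=-S(x)$ for all $x\in[0,\infty)$; (S2) $0<S(x)<x$ for all $x\in(0,a)$; (S3) $S\in C([0,a])\cap C^1([0,a))\cap C^2([0,a)\setminus P)$; (S4) $S'(x)^2-S''(x)S(x)\geq 1$ for all $x\in[0,a)\setminus P$. Then $$\frac{a^2-x^2}{a^2+x^2}\leq\frac{S(x)}{x}\quad\text{for all } x\in\mathbb{R},\ x\neq 0.$$
   Context: In (S3) and (S4), regularity and derivatives refer to the restriction of $S$ to the indicated sets; derivatives at the endpoint $0$ are one-sided (from the right). The set $P$ may be empty. *)

theory Defs
  imports "HOL-Analysis.Analysis"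
begin

text \<open>
  All derivatives are taken within \<open>A\<close>, so that they depend only on the restriction of \<open>f\<close> to \<open>A\<close>
  and are one-sided at an endpoint of \<open>A\<close>. The value of \<open>deriv_on A f x\<close> is meaningful only if
  \<open>f\<close> is differentiable at \<open>x\<close> within \<open>A\<close> and \<open>x\<close> is a limit point of \<open>A\<close>.
\<close>

definition deriv_on :: "real set \<Rightarrow> (real \<Rightarrow> real) \<Rightarrow> real \<Rightarrow> real" where
  "deriv_on A f x = vector_derivative f (at x within A)"

primrec Ck_on :: "nat \<Rightarrow> real set \<Rightarrow> (real \<Rightarrow> real) \<Rightarrow> bool" where
  "Ck_on 0 A f \<longleftrightarrow> continuous_on A f"
| "Ck_on (Suc k) A f \<longleftrightarrow> f differentiable_on A \<and> Ck_on k A (deriv_on A f)"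

end

theory Submission
  imports Defs
begin

text \<open>
  The curvature hypothesis \<open>S'\<^sup>2 - S'' S \<ge> 1\<close> says that \<open>(ln S)'' \<le> - 1 / S\<^sup>2\<close>, while the
  minorant \<open>q x = x (a\<^sup>2 - x\<^sup>2) / (a\<^sup>2 + x\<^sup>2)\<close> satisfies the opposite inequality
  \<open>(ln q)'' \<ge> - 1 / q\<^sup>2\<close> on \<open>(0, a)\<close>. So \<open>h = ln (S / q)\<close> has
  \<open>h'' \<le> 1 / q\<^sup>2 - 1 / S\<^sup>2\<close>, which is negative wherever \<open>h < 0\<close>: the function \<open>h\<close> is concave on
  the set where the claim \<open>S \<ge> q\<close> fails. Such a function can violate \<open>h \<ge> 0\<close> only through its
  boundary behaviour, and both ends are under control.

  At \<open>0\<close>, the curvature hypothesis gives \<open>S'(0) \<ge> 1\<close>, so \<open>h\<close> comes arbitrarily close to \<open>0\<close> from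
  below or exceeds it. If \<open>h\<close> is negative somewhere, it must therefore have descended, and by
  concavity the descent never stops (\<open>descent_continues\<close>): \<open>S \<le> \<theta> q \<le> \<theta> (a - x)\<close> near \<open>a\<close> for
  some \<open>\<theta> < 1\<close>.

  At \<open>a\<close>, log-concavity forces \<open>S' < 0\<close> eventually, and from there on the energy
  \<open>(S'\<^sup>2 - 1) / S\<^sup>2\<close>, which is constant for \<open>sin (\<kappa> x) / \<kappa>\<close>, is nondecreasing. Being bounded
  below while \<open>S \<rightarrow> 0\<close>, it forces \<open>S'\<close> to end up below every level above \<open>-1\<close>. So for each
  \<open>\<theta>' < 1\<close> one has \<open>S \<ge> \<theta>' (a - x)\<close> near \<open>a\<close> (\<open>terminal_slope\<close>); a \<open>\<theta>'\<close> above \<open>\<theta>\<close> gives a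
  contradiction.

  Beyond \<open>a\<close> the estimate is crude: \<open>\<bar>S x\<bar> \<le> x\<close> propagates from \<open>[0, a)\<close> to all \<open>x \<ge> 0\<close> by
  antiperiodicity, hence \<open>S x \<ge> - (x - a)\<close> for \<open>x \<ge> a\<close>, which is enough. Oddness covers \<open>x < 0\<close>.
\<close>

section \<open>Monotonicity and concavity with exceptional points\<close>

text \<open>
  The fundamental theorem of calculus tolerates finitely many points without a derivative, so the
  increment of \<open>f\<close> is the integral of a nonpositive function.
\<close>

lemma nonincreasing_off_finite:
  fixes f :: "real \<Rightarrow> real"
  assumes "finite P" and "x \<le> y" and cont: "continuous_on {x..y} f"
    and der: "\<And>t. t \<in> {x<..<y} - P \<Longrightarrow> \<exists>d\<le>0. (f has_real_derivative d) (at t)"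
  shows "f y \<le> f x"
proof -
  obtain D where D: "\<And>t. t \<in> {x<..<y} - P \<Longrightarrow> D t \<le> 0 \<and> (f has_real_derivative D t) (at t)"
    using der by metis
  \<comment> \<open>The integrand has to be nonpositive everywhere, also where \<open>D\<close> is unconstrained.\<close>
  define D0 where "D0 t = (if t \<in> {x<..<y} - P then D t else 0)" for t
  have "(D0 has_integral (f y - f x)) {x..y}"
  proof (rule fundamental_theorem_of_calculus_interior_strong[OF \<open>finite P\<close> \<open>x \<le> y\<close> _ cont])
    fix t assume "t \<in> {x<..<y} - P"
    with D[OF this] show "(f has_vector_derivative D0 t) (at t)"
      by (simp add: D0_def has_real_derivative_iff_has_vector_derivative)
  qed
  then have "f y - f x \<le> 0"
    by (rule has_integral_le[OF _ has_integral_0]) (use D in \<open>auto simp: D0_def\<close>)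
  then show ?thesis by simp
qed

text \<open>
  The mean value theorem alone would yield a point of negative slope somewhere between \<open>y\<close> and
  \<open>x\<close>. Starting it from the last point at which the level \<open>r\<close> is still attained places that point
  below the level as well.
\<close>

lemma negative_slope_below_level:
  fixes h :: "real \<Rightarrow> real"
  assumes "y < x" and low: "h x < r" and high: "r \<le> h y"
    and der: "\<And>t. t \<in> {y..x} \<Longrightarrow> (h has_real_derivative k t) (at t)"
  shows "\<exists>c\<in>{y<..<x}. h c < r \<and> k c < 0"
proof -
  have cont: "continuous_on {y..x} h"
    using der by (meson DERIV_isCont continuous_at_imp_continuous_on)
  let ?T = "{t \<in> {y..x}. r \<le> h t}"
  have "closed ?T"
    by (rule continuous_on_closed_Collect_le[OF continuous_on_const cont]) simp
  moreover have "{y..x} \<inter> ?T = ?T" by auto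
  ultimately have "compact ?T" by (metis compact_Int_closed compact_Icc)
  moreover have "y \<in> ?T" using high \<open>y < x\<close> by simp
  then have "?T \<noteq> {}" by blast
  ultimately obtain t where t: "t \<in> ?T" and last: "\<And>s. s \<in> ?T \<Longrightarrow> s \<le> t"
    by (meson compact_attains_sup)
  have "t < x" using t low by (cases "t = x") auto
  obtain c where c: "t < c" "c < x" "h x - h t = (x - t) * k c"
    using MVT2[OF \<open>t < x\<close>, of h k] der t by auto
  have "(x - t) * k c < 0" using c(3) low t by simp
  then have "k c < 0" using \<open>t < x\<close> by (simp add: mult_less_0_iff)
  moreover have "h c < r" using last[of c] c t by force
  ultimately show ?thesis using c t by auto
qed

text \<open>
  Where \<open>h\<close> is negative its slope is nonincreasing, so a negative \<open>h\<close> with nonpositive slope keeps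
  decreasing, and decreasing keeps it negative. The circularity is resolved by looking at the first
  point at which \<open>h\<close> would be nonnegative again: all points before it obey the slope bound.
\<close>

lemma descent_continues:
  fixes h k :: "real \<Rightarrow> real"
  assumes "finite P"
    and dh: "\<And>t. t \<in> {c..z} \<Longrightarrow> (h has_real_derivative k t) (at t)"
    and ck: "continuous_on {c..z} k"
    and dk: "\<And>t. t \<in> {c<..<z} - P \<Longrightarrow> h t < 0 \<Longrightarrow> \<exists>d\<le>0. (k has_real_derivative d) (at t)"
    and start: "h c < 0" "k c \<le> 0" and "c \<le> z"
  shows "h z \<le> h c"
proof -
  have step: "h s \<le> h c" if s: "s \<in> {c..z}" and neg: "\<And>t. t \<in> {c<..<s} \<Longrightarrow> h t < 0" for s
  proof -
    have "k t \<le> 0" if t: "t \<in> {c..s}" for t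
    proof -
      have "k t \<le> k c"
        by (rule nonincreasing_off_finite[OF \<open>finite P\<close>])
          (use s t neg dk in \<open>auto intro: continuous_on_subset[OF ck]\<close>)
      then show ?thesis using start by simp
    qed
    then show ?thesis
      using s dh by (intro DERIV_nonpos_imp_nonincreasing[of c s h]) force+
  qed
  have neg: "h s < 0" if s: "s \<in> {c..z}" for s
  proof (rule ccontr)
    assume nn: "\<not> h s < 0"
    let ?T = "{t \<in> {c..s}. 0 \<le> h t}"
    have cont: "continuous_on {c..s} h"
      using dh s by (meson DERIV_isCont continuous_at_imp_continuous_on atLeastAtMost_iff order_trans)
    have "closed ?T"
      by (rule continuous_on_closed_Collect_le[OF continuous_on_const cont]) simp
    moreover have "{c..s} \<inter> ?T = ?T" by auto
    ultimately have "compact ?T" by (metis compact_Int_closed compact_Icc)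
    moreover have "?T \<noteq> {}" using nn s by auto
    ultimately obtain b where b: "b \<in> ?T" and first: "\<And>t. t \<in> ?T \<Longrightarrow> b \<le> t"
      by (meson compact_attains_inf)
    have "h b \<le> h c"
    proof (rule step)
      show "b \<in> {c..z}" using b s by auto
      fix t assume "t \<in> {c<..<b}"
      then show "h t < 0" using first[of t] b by force
    qed
    then show False using b start by simp
  qed
  show ?thesis by (rule step) (use \<open>c \<le> z\<close> neg in auto)
qed

section \<open>Arches satisfying the curvature inequality\<close>

text \<open>
  One arch of \<open>S\<close>, with the one-sided derivatives replaced by ordinary ones on the open interval.
  The left endpoint enters only through the initial slope, which is a separate hypothesis of
  \<open>redheffer_on_arch\<close>.
\<close>

locale log_concave_arch =
  fixes S S' S'' :: "real \<Rightarrow> real" and a :: real and P :: "real set"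
  assumes a_pos: "0 < a" and finite_P: "finite P"
    and cont_S: "continuous_on {0..a} S" and S_a: "S a = 0"
    and S_pos: "\<And>x. x \<in> {0<..<a} \<Longrightarrow> 0 < S x"
    and DERIV_S: "\<And>x. x \<in> {0<..<a} \<Longrightarrow> (S has_real_derivative S' x) (at x)"
    and cont_S': "continuous_on {0<..<a} S'"
    and DERIV_S': "\<And>x. x \<in> {0<..<a} - P \<Longrightarrow> (S' has_real_derivative S'' x) (at x)"
    and ineq: "\<And>x. x \<in> {0<..<a} - P \<Longrightarrow> 1 \<le> (S' x)\<^sup>2 - S'' x * S x"
begin

lemma cont_S_open: "continuous_on {0<..<a} S"
  by (rule continuous_on_subset[OF cont_S]) auto

lemma cont_log_deriv: "continuous_on {0<..<a} (\<lambda>x. S' x / S x)"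
  by (intro continuous_intros cont_S' cont_S_open) (use S_pos in force)

text \<open>
  This is the curvature inequality divided by \<open>S\<^sup>2\<close>, the form in which it is used below.
\<close>

lemma DERIV_log_deriv:
  assumes x: "x \<in> {0<..<a} - P"
  shows "\<exists>d\<le>- 1 / (S x)\<^sup>2. ((\<lambda>x. S' x / S x) has_real_derivative d) (at x)"
proof (intro exI conjI)
  have pos: "0 < S x" using S_pos x by auto
  show "((\<lambda>x. S' x / S x) has_real_derivative (S'' x * S x - (S' x)\<^sup>2) / (S x)\<^sup>2) (at x)"
    using pos x by (auto intro!: derivative_eq_intros DERIV_S DERIV_S' simp: power2_eq_square)
  show "(S'' x * S x - (S' x)\<^sup>2) / (S x)\<^sup>2 \<le> - 1 / (S x)\<^sup>2"
    using ineq[OF x] by (intro divide_right_mono) auto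
qed

lemma log_deriv_nonincreasing:
  assumes "0 < x" "x \<le> y" "y < a"
  shows "S' y / S y \<le> S' x / S x"
proof (rule nonincreasing_off_finite[OF finite_P \<open>x \<le> y\<close>])
  show "continuous_on {x..y} (\<lambda>x. S' x / S x)"
    by (rule continuous_on_subset[OF cont_log_deriv]) (use assms in auto)
  fix t assume "t \<in> {x<..<y} - P"
  then have t: "t \<in> {0<..<a} - P" using assms by auto
  have "- 1 / (S t)\<^sup>2 \<le> 0" by simp
  then show "\<exists>d\<le>0. ((\<lambda>x. S' x / S x) has_real_derivative d) (at t)"
    using DERIV_log_deriv[OF t] order_trans by blast
qed

lemma mean_slope_to_end:
  assumes x: "x \<in> {0<..<a}"
  shows "\<exists>z\<in>{x<..<a}. S x = - (a - x) * S' z"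
proof -
  have "\<exists>l z. x < z \<and> z < a \<and> DERIV S z :> l \<and> S a - S x = (a - x) * l"
  proof (rule MVT)
    show "x < a" using x by simp
    show "continuous_on {x..a} S" by (rule continuous_on_subset[OF cont_S]) (use x in auto)
    show "S differentiable (at z)" if "x < z" "z < a" for z
      using DERIV_S[of z] that x by (auto simp: real_differentiable_def)
  qed
  then obtain l z where z: "x < z" "z < a" "DERIV S z :> l" "S a - S x = (a - x) * l" by blast
  have "l = S' z" using DERIV_unique[OF z(3) DERIV_S] z x by auto
  then have "S x = - (a - x) * S' z" using z(4) S_a by (simp add: algebra_simps)
  then show ?thesis using z by (intro bexI[of _ z]) auto
qed

text \<open>
  Since \<open>S\<close> is positive at \<open>a / 2\<close> and zero at \<open>a\<close>, it has a negative slope somewhere, and the sign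
  of \<open>S' / S\<close> cannot change back.
\<close>

lemma eventually_falling: "\<exists>d\<in>{0<..<a}. \<forall>x\<in>{d..<a}. S' x < 0"
proof -
  obtain d where d: "d \<in> {a / 2<..<a}" "S (a / 2) = - (a - a / 2) * S' d"
    using mean_slope_to_end[of "a / 2"] a_pos by auto
  have d0: "d \<in> {0<..<a}" using d a_pos by auto
  have "0 < S (a / 2)" using S_pos[of "a / 2"] a_pos by simp
  then have "S' d < 0" using d(2) a_pos by (simp add: mult_less_0_iff)
  then have "S' d / S d < 0" using S_pos[OF d0] by (simp add: divide_neg_pos)
  have "S' x < 0" if x: "x \<in> {d..<a}" for x
  proof -
    have "S' x / S x < 0"
      using log_deriv_nonincreasing[of d x] x d0 \<open>S' d / S d < 0\<close> by auto
    moreover have "0 < S x" using S_pos x d0 by auto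
    ultimately show ?thesis by (simp add: divide_less_0_iff)
  qed
  then show ?thesis using d0 by blast
qed

text \<open>
  With \<open>p = S' / S\<close> the energy is \<open>p\<^sup>2 - 1 / S\<^sup>2\<close>, whose derivative is
  \<open>2 p (p' + 1 / S\<^sup>2)\<close>. The second factor is nonpositive by the curvature inequality, and the first
  one is negative where \<open>S\<close> falls.
\<close>

lemma energy_nondecreasing:
  assumes "0 < x" "x \<le> y" "y < a" and falling: "\<And>t. t \<in> {x..y} \<Longrightarrow> S' t < 0"
  shows "((S' x)\<^sup>2 - 1) / (S x)\<^sup>2 \<le> ((S' y)\<^sup>2 - 1) / (S y)\<^sup>2"
proof -
  define E where "E t = (S' t / S t)\<^sup>2 - 1 / (S t)\<^sup>2" for t
  have "- E y \<le> - E x"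
  proof (rule nonincreasing_off_finite[OF finite_P \<open>x \<le> y\<close>])
    have pos: "0 < S t" if "t \<in> {x..y}" for t using S_pos assms that by auto
    show "continuous_on {x..y} (\<lambda>t. - E t)"
      unfolding E_def
      by (intro continuous_intros continuous_on_subset[OF cont_S_open]
          continuous_on_subset[OF cont_S']) (use assms pos in force)+
    fix t assume t: "t \<in> {x<..<y} - P"
    then have t0: "t \<in> {0<..<a} - P" and St: "0 < S t" and S't: "S' t < 0"
      using assms pos by auto
    obtain d where d: "d \<le> - 1 / (S t)\<^sup>2" "((\<lambda>x. S' x / S x) has_real_derivative d) (at t)"
      using DERIV_log_deriv[OF t0] by blast
    have "((\<lambda>t. - E t) has_real_derivative - (2 * (S' t / S t) * (d + 1 / (S t)\<^sup>2))) (at t)"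
      unfolding E_def
      by (rule derivative_eq_intros d(2) DERIV_S refl | use St t0 in force)+
        (use St in \<open>simp add: field_simps power2_eq_square power3_eq_cube power4_eq_xxxx\<close>)
    moreover have "- (2 * (S' t / S t) * (d + 1 / (S t)\<^sup>2)) \<le> 0"
    proof -
      have "2 * (S' t / S t) \<le> 0" using St S't by (simp add: divide_le_0_iff)
      moreover have "d + 1 / (S t)\<^sup>2 \<le> 0" using d(1) by simp
      ultimately show ?thesis using mult_nonpos_nonpos by fastforce
    qed
    ultimately show "\<exists>d\<le>0. ((\<lambda>t. - E t) has_real_derivative d) (at t)" by blast
  qed
  then show ?thesis by (simp add: E_def power_divide diff_divide_distrib)
qed

text \<open>
  The energy bound \<open>S'\<^sup>2 \<ge> 1 + K S\<^sup>2\<close>, in which \<open>K\<close> may be negative, exceeds \<open>\<theta>\<^sup>2\<close> as soon as \<open>S\<close> is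
  small. Hence \<open>S' \<le> - \<theta>\<close> on a left neighbourhood of \<open>a\<close>, and \<open>S\<close> falls to \<open>0\<close> at least that
  steeply.
\<close>

lemma terminal_slope:
  assumes th: "0 < \<theta>" "\<theta> < 1"
  shows "\<exists>d\<in>{0<..<a}. \<forall>x\<in>{d..<a}. \<theta> * (a - x) \<le> S x"
proof -
  obtain d where d: "d \<in> {0<..<a}" and falling: "\<And>x. x \<in> {d..<a} \<Longrightarrow> S' x < 0"
    using eventually_falling by blast
  define K where "K = ((S' d)\<^sup>2 - 1) / (S d)\<^sup>2"
  have "((\<lambda>x. 1 + K * (S x)\<^sup>2) \<longlongrightarrow> 1 + K * (S a)\<^sup>2) (at a within {0..a})"
    using cont_S a_pos by (intro tendsto_intros) (auto simp: continuous_on_def)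
  moreover have "\<theta>\<^sup>2 < 1 + K * (S a)\<^sup>2"
    using th by (simp add: S_a power_less_one_iff abs_square_less_1)
  ultimately have "\<forall>\<^sub>F x in at a within {0..a}. \<theta>\<^sup>2 < 1 + K * (S x)\<^sup>2"
    by (rule order_tendstoD)
  then obtain e where e: "0 < e"
    and near: "\<And>x. x \<in> {0..a} \<Longrightarrow> x \<noteq> a \<Longrightarrow> dist x a < e \<Longrightarrow> \<theta>\<^sup>2 < 1 + K * (S x)\<^sup>2"
    unfolding eventually_at by blast
  define b where "b = max d (a - e / 2)"
  have b: "b \<in> {0<..<a}" using d e by (auto simp: b_def)
  have steep: "S' x \<le> - \<theta>" if x: "x \<in> {b..<a}" for x
  proof -
    have xd: "x \<in> {d..<a}" "x \<in> {0<..<a}" using x d by (auto simp: b_def)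
    have "K \<le> ((S' x)\<^sup>2 - 1) / (S x)\<^sup>2"
      unfolding K_def by (rule energy_nondecreasing) (use xd d falling in auto)
    then have "1 + K * (S x)\<^sup>2 \<le> (S' x)\<^sup>2"
      using S_pos[OF xd(2)] by (simp add: pos_le_divide_eq)
    moreover have "\<theta>\<^sup>2 < 1 + K * (S x)\<^sup>2"
      by (rule near) (use x xd e in \<open>auto simp: b_def dist_real_def\<close>)
    ultimately have "\<theta>\<^sup>2 \<le> (- S' x)\<^sup>2" by simp
    then have "\<theta> \<le> - S' x"
      using falling[OF xd(1)] by (intro power2_le_imp_le[of \<theta> "- S' x"]) auto
    then show ?thesis by simp
  qed
  have "\<theta> * (a - x) \<le> S x" if x: "x \<in> {b..<a}" for x
  proof -
    obtain z where z: "z \<in> {x<..<a}" "S x = - (a - x) * S' z"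
      using mean_slope_to_end[of x] x b by auto
    have "S' z \<le> - \<theta>" using steep[of z] z x by auto
    then have "(a - x) * S' z \<le> (a - x) * - \<theta>" using x by (intro mult_left_mono) auto
    then show ?thesis using z(2) by (simp add: algebra_simps)
  qed
  then show ?thesis using b by blast
qed

section \<open>Comparison with the rational minorant\<close>

text \<open>
  The hypothesis \<open>initial\<close> is the weak form of \<open>S'(0) \<ge> 1\<close> that the argument needs: it provides
  points near \<open>0\<close> at which \<open>h = ln (S / q)\<close> exceeds any given negative level, because \<open>q y \<le> y\<close>.
\<close>

theorem redheffer_on_arch:
  assumes initial: "\<And>\<theta> x. \<theta> < 1 \<Longrightarrow> 0 < x \<Longrightarrow> \<exists>y\<in>{0<..<x}. \<theta> * y < S y"
    and x: "x \<in> {0<..<a}"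
  shows "x * (a\<^sup>2 - x\<^sup>2) / (a\<^sup>2 + x\<^sup>2) \<le> S x"
proof (rule ccontr)
  define q where "q t = t * (a\<^sup>2 - t\<^sup>2) / (a\<^sup>2 + t\<^sup>2)" for t
  \<comment> \<open>This is \<open>q' / q\<close>, written as the derivative of \<open>ln t + ln (a\<^sup>2 - t\<^sup>2) - ln (a\<^sup>2 + t\<^sup>2)\<close>.\<close>
  define r where "r t = 1 / t - 2 * t / (a\<^sup>2 - t\<^sup>2) - 2 * t / (a\<^sup>2 + t\<^sup>2)" for t
  define h where "h t = ln (S t) - ln (q t)" for t
  define k where "k t = S' t / S t - r t" for t
  have sq: "0 < a\<^sup>2 - t\<^sup>2" "0 < a\<^sup>2 + t\<^sup>2" if "t \<in> {0<..<a}" for t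
    using that power_strict_mono[of t a 2] by (auto intro!: add_pos_pos)
  have q_pos: "0 < q t" if "t \<in> {0<..<a}" for t
    using that sq[OF that] by (simp add: q_def)
  have h_le: "h t < l \<longleftrightarrow> S t < exp l * q t" if "t \<in> {0<..<a}" for t l
  proof -
    have "h t < l \<longleftrightarrow> ln (S t / q t) < l"
      using S_pos[OF that] q_pos[OF that] by (simp add: h_def ln_div)
    also have "\<dots> \<longleftrightarrow> S t / q t < exp l"
      using S_pos[OF that] q_pos[OF that] by (metis divide_pos_pos exp_less_mono exp_ln ln_exp ln_less_cancel_iff exp_gt_zero)
    finally show ?thesis using q_pos[OF that] by (simp add: pos_divide_less_eq)
  qed
  have DERIV_h: "(h has_real_derivative k t) (at t)" if t: "t \<in> {0<..<a}" for t
  proof -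
    have "((\<lambda>t. ln (S t) - (ln t + ln (a\<^sup>2 - t\<^sup>2) - ln (a\<^sup>2 + t\<^sup>2))) has_real_derivative k t) (at t)"
      using t S_pos[OF t] sq[OF t]
      by (auto intro!: derivative_eq_intros DERIV_S simp: k_def r_def)
    then show ?thesis
    proof (rule has_field_derivative_transform_within_open[OF _ open_greaterThanLessThan t])
      fix s assume "s \<in> {0<..<a}"
      then show "ln (S s) - (ln s + ln (a\<^sup>2 - s\<^sup>2) - ln (a\<^sup>2 + s\<^sup>2)) = h s"
        using sq[of s] by (simp add: h_def q_def ln_mult ln_div)
    qed
  qed
  have cont_k: "continuous_on {0<..<a} k"
    unfolding k_def r_def
    by (intro continuous_intros cont_log_deriv) (auto dest: sq)
  have DERIV_k: "\<exists>d\<le>0. (k has_real_derivative d) (at t)"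
    if t: "t \<in> {0<..<a} - P" and neg: "h t < 0" for t
  proof -
    have t0: "t \<in> {0<..<a}" using t by simp
    define r' where "r' = - 1 / t\<^sup>2 - 2 * (a\<^sup>2 + t\<^sup>2) / (a\<^sup>2 - t\<^sup>2)\<^sup>2 - 2 * (a\<^sup>2 - t\<^sup>2) / (a\<^sup>2 + t\<^sup>2)\<^sup>2"
    have "(r has_real_derivative r') (at t)"
      unfolding r_def
      using t0 sq[OF t0]
      by (auto intro!: derivative_eq_intros simp: r'_def power2_eq_square algebra_simps)
    moreover obtain d where d: "d \<le> - 1 / (S t)\<^sup>2" "((\<lambda>x. S' x / S x) has_real_derivative d) (at t)"
      using DERIV_log_deriv[OF t] by blast
    ultimately have "(k has_real_derivative d - r') (at t)"
      unfolding k_def by (intro DERIV_diff)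
    moreover have "- 1 / (q t)\<^sup>2 \<le> r'"
    proof -
      \<comment> \<open>In the variables \<open>u\<close> and \<open>v\<close>, \<open>q\<^sup>2 = t\<^sup>2 u\<^sup>2 / v\<^sup>2\<close> and \<open>v - u = 2 t\<^sup>2\<close> reduce the
        claim to \<open>u \<le> v\<close>.\<close>
      define u where "u = a\<^sup>2 - t\<^sup>2"
      define v where "v = a\<^sup>2 + t\<^sup>2"
      have uv: "0 < u" "0 < v" "u \<le> v" using sq[OF t0] by (auto simp: u_def v_def)
      have t2: "t\<^sup>2 = (v - u) / 2" by (simp add: u_def v_def)
      have vu: "u < v" using zero_less_power[of t 2] t0 by (simp add: u_def v_def)
      have "r' + 1 / (q t)\<^sup>2 = - 1 / t\<^sup>2 - 2 * v / u\<^sup>2 - 2 * u / v\<^sup>2 + v\<^sup>2 / (t\<^sup>2 * u\<^sup>2)"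
        by (simp add: r'_def q_def u_def v_def power_mult_distrib power_divide)
      also have "\<dots> = 2 * (v\<^sup>2 - u\<^sup>2) / (u * v\<^sup>2)"
        unfolding t2 using uv vu
        by (simp add: divide_simps power2_eq_square, algebra)
      also have "\<dots> \<ge> 0" using uv by (auto intro!: divide_nonneg_nonneg power_mono)
      finally show ?thesis by simp
    qed
    moreover have "- 1 / (S t)\<^sup>2 \<le> - 1 / (q t)\<^sup>2"
    proof -
      have "S t \<le> q t" using neg h_le[OF t0, of 0] by simp
      then have "(S t)\<^sup>2 \<le> (q t)\<^sup>2" using S_pos[OF t0] by (intro power_mono) auto
      then show ?thesis using S_pos[OF t0] by (simp add: frac_le)
    qed
    ultimately show ?thesis using d(1) by (intro exI[of _ "d - r'"]) auto
  qed
  assume "\<not> x * (a\<^sup>2 - x\<^sup>2) / (a\<^sup>2 + x\<^sup>2) \<le> S x"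
  then have "h x < 0" using h_le[OF x, of 0] by (simp add: q_def)
  \<comment> \<open>Any level strictly between \<open>h x\<close> and \<open>0\<close> would do.\<close>
  define l where "l = h x / 2"
  have l: "h x < l" "l < 0" using \<open>h x < 0\<close> by (auto simp: l_def)
  obtain y where y: "y \<in> {0<..<x}" "exp l * y < S y"
    using initial[of "exp l" x] l x by auto
  have y0: "y \<in> {0<..<a}" using y x by auto
  have "q y \<le> y"
    using sq[OF y0] y by (simp add: q_def divide_simps mult_left_mono)
  then have "exp l * q y \<le> exp l * y" by simp
  with y(2) have "exp l * q y < S y" by linarith
  then have "l \<le> h y" using h_le[OF y0, of l] by linarith
  then obtain c where c: "c \<in> {y<..<x}" "h c < l" "k c < 0"
    using negative_slope_below_level[of y x h l k] y l x DERIV_h by auto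
  then have c0: "c \<in> {0<..<a}" "h c < 0" using y x l by auto
  \<comment> \<open>The strict inequality \<open>exp (h c) < \<theta>\<close> turns \<open>h z \<le> h c\<close> into \<open>S z < \<theta> q z\<close>.\<close>
  define \<theta> where "\<theta> = (1 + exp (h c)) / 2"
  have th: "exp (h c) < \<theta>" "0 < \<theta>" "\<theta> < 1" using c0 by (auto simp: \<theta>_def add_pos_pos)
  obtain d where d: "d \<in> {0<..<a}" "\<And>x. x \<in> {d..<a} \<Longrightarrow> \<theta> * (a - x) \<le> S x"
    using terminal_slope[OF th(2,3)] by blast
  define z where "z = max c d"
  have z: "z \<in> {0<..<a}" "c \<le> z" "z \<in> {d..<a}" using c0 d by (auto simp: z_def)
  have "h z \<le> h c"
    by (rule descent_continues[OF finite_P, of c z h k])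
      (use z c0 c DERIV_h DERIV_k in \<open>auto intro: continuous_on_subset[OF cont_k]\<close>)
  then have "h z < ln \<theta>" using th by (smt (verit) ln_exp ln_less_cancel_iff exp_gt_zero)
  then have "S z < \<theta> * q z" using h_le[OF z(1)] th by simp
  moreover have "q z \<le> a - z"
  proof -
    have "z * (a + z) \<le> a\<^sup>2 + z\<^sup>2"
      using z(1) mult_right_mono[of z a a] by (simp add: power2_eq_square algebra_simps)
    then have "(a - z) * (z * (a + z)) \<le> (a - z) * (a\<^sup>2 + z\<^sup>2)"
      using z(1) by (intro mult_left_mono) auto
    moreover have "q z = (a - z) * (z * (a + z)) / (a\<^sup>2 + z\<^sup>2)"
      by (simp add: q_def power2_eq_square algebra_simps)
    ultimately show ?thesis using sq[OF z(1)] by (simp add: pos_divide_le_eq)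
  qed
  then have "\<theta> * q z \<le> \<theta> * (a - z)" using th by simp
  ultimately show False using d(2)[OF z(3)] by simp
qed

end

section \<open>The inequality on the real line\<close>

theorem theorem1p1:
  fixes S :: "real \<Rightarrow> real" and a :: real and P :: "real set"
  assumes a: "0 < a"
    and P: "finite P" "P \<subseteq> {0<..<a}"
    and S1: "\<forall>x\<ge>0. S (- x) = - S x \<and> S (a + x) = - S x"
    and S2: "\<forall>x\<in>{0<..<a}. 0 < S x \<and> S x < x"
    and S3: "Ck_on 0 {0..a} S" "Ck_on 1 {0..<a} S" "Ck_on 2 ({0..<a} - P) S"
    and S4: "\<forall>x\<in>{0..<a} - P.
      (deriv_on ({0..<a} - P) S x)\<^sup>2
        - deriv_on ({0..<a} - P) (deriv_on ({0..<a} - P) S) x * S x \<ge> 1"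
  shows "\<forall>x. x \<noteq> 0 \<longrightarrow> (a\<^sup>2 - x\<^sup>2) / (a\<^sup>2 + x\<^sup>2) \<le> S x / x"
proof -
  let ?B = "{0..<a}" and ?A = "{0..<a} - P"
  define S' where "S' = deriv_on ?B S"
  define T where "T = deriv_on ?A S"
  define S'' where "S'' = deriv_on ?A T"
  have S_0: "S 0 = 0" using S1 by (metis add.inverse_neutral equal_neg_zero order_refl)
  have S_a: "S a = 0" using S1 S_0 by (metis add.right_neutral neg_equal_0_iff_equal order_refl)
  have diffS: "S differentiable_on ?B" and contS': "continuous_on ?B S'"
    using S3(2) by (simp_all add: S'_def)
  have diffSA: "S differentiable_on ?A" and diffT: "T differentiable_on ?A"
    using S3(3) by (simp_all add: T_def numeral_2_eq_2)
  have interior: "at x within ?B = at x" if "x \<in> {0<..<a}" for x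
    by (rule at_within_open_subset[of _ "{0<..<a}"]) (use that in auto)
  have openA: "open ({0<..<a} - P)"
    using P by (intro open_Diff finite_imp_closed) auto
  have interiorA: "at x within ?A = at x" if "x \<in> {0<..<a} - P" for x
    by (rule at_within_open_subset[OF that openA]) auto
  have DERIV_S: "(S has_real_derivative S' x) (at x)" if x: "x \<in> {0<..<a}" for x
  proof -
    have "S differentiable (at x within ?B)"
      using diffS x by (auto simp: differentiable_on_def)
    then show ?thesis
      using interior[OF x] x
      by (simp add: S'_def deriv_on_def has_real_derivative_iff_has_vector_derivative
          vector_derivative_works)
  qed
  \<comment> \<open>\<open>T\<close> and \<open>S'\<close> are derivatives within different sets; they agree at interior points.\<close>
  have T_eq: "T x = S' x" if x: "x \<in> {0<..<a} - P" for x
    using x interior[of x] interiorA[of x] by (simp add: T_def S'_def deriv_on_def)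
  have DERIV_S': "(S' has_real_derivative S'' x) (at x)" if x: "x \<in> {0<..<a} - P" for x
  proof -
    have "T differentiable (at x within ?A)"
      using diffT x by (auto simp: differentiable_on_def)
    then have "(T has_real_derivative S'' x) (at x)"
      using interiorA[OF x]
      by (simp add: S''_def deriv_on_def has_real_derivative_iff_has_vector_derivative
          vector_derivative_works)
    then show ?thesis
      by (rule has_field_derivative_transform_within_open[OF _ openA x]) (rule T_eq)
  qed
  interpret log_concave_arch S S' S'' a P
  proof
    fix x assume x: "x \<in> {0<..<a} - P"
    then have "x \<in> ?A" by auto
    then show "1 \<le> (S' x)\<^sup>2 - S'' x * S x"
      using S4[folded T_def, folded S''_def] T_eq[OF x] by metis
  qed (use a P S3(1) S_a S2 DERIV_S DERIV_S' in \<open>auto intro: continuous_on_subset[OF contS']\<close>)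
  have initial: "\<exists>y\<in>{0<..<x}. \<theta> * y < S y" if th: "\<theta> < 1" and x: "0 < x" for \<theta> x
  proof -
    \<comment> \<open>At \<open>0\<close> the curvature inequality reads \<open>S'(0)\<^sup>2 \<ge> 1\<close>, because \<open>S 0 = 0\<close>; positivity of \<open>S\<close>
      fixes the sign of the square root.\<close>
    have zA: "0 \<in> ?A" using a P by auto
    have openN: "open ({..<a} - P)"
      using P by (intro open_Diff finite_imp_closed) auto
    have nbh: "at 0 within ?A = at_right 0"
      by (rule at_within_nhd[of _ "{..<a} - P", OF _ openN]) (use zA a in auto)
    have "S differentiable (at 0 within ?A)"
      using diffSA zA by (auto simp: differentiable_on_def)
    then have "(S has_real_derivative T 0) (at 0 within ?A)"
      by (simp add: T_def deriv_on_def has_real_derivative_iff_has_vector_derivative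
          vector_derivative_works)
    then have lim: "((\<lambda>y. S y / y) \<longlongrightarrow> T 0) (at_right 0)"
      by (simp add: nbh has_field_derivative_iff S_0)
    have "\<forall>\<^sub>F y in at_right 0. 0 \<le> S y / y"
      using eventually_at_right_real[OF a] by eventually_elim (use S2 in \<open>auto intro!: divide_nonneg_pos less_imp_le\<close>)
    then have "0 \<le> T 0" by (rule tendsto_lowerbound[OF lim]) simp
    moreover have "1 \<le> (T 0)\<^sup>2"
      using bspec[OF S4 zA] S_0 by (simp add: T_def)
    ultimately have "1 \<le> T 0" using power2_le_imp_le[of 1 "T 0"] by simp
    then have "\<forall>\<^sub>F y in at_right 0. \<theta> < S y / y"
      using order_tendstoD(1)[OF lim] th by simp
    then have "\<forall>\<^sub>F y in at_right 0. y \<in> {0<..<x} \<and> \<theta> < S y / y"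
      using eventually_at_right_real[OF x] by eventually_elim auto
    then obtain y where "y \<in> {0<..<x}" "\<theta> < S y / y"
      using eventually_happens'[of "at_right (0::real)"] by auto
    then show ?thesis by (auto simp: pos_less_divide_eq)
  qed
  have abs_le: "\<bar>S x\<bar> \<le> x" if "0 \<le> x" "x \<le> real n * a" for n x
    using that
  proof (induction n arbitrary: x)
    case 0
    then show ?case using S_0 by simp
  next
    case (Suc n)
    show ?case
    proof (cases "x < a")
      case True
      show ?thesis
      proof (cases "x = 0")
        case False
        then show ?thesis using S2[rule_format, of x] \<open>x < a\<close> Suc.prems by simp
      qed (simp add: S_0)
    next
      case False
      have "\<bar>S (x - a)\<bar> \<le> x - a"
        by (rule Suc.IH) (use False Suc.prems in \<open>auto simp: algebra_simps\<close>)
      moreover have "S x = - S (x - a)"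
        using S1[rule_format, of "x - a"] False by simp
      ultimately show ?thesis using a by simp
    qed
  qed
  have pos: "(a\<^sup>2 - x\<^sup>2) / (a\<^sup>2 + x\<^sup>2) \<le> S x / x" if x: "0 < x" for x
  proof (cases "x < a")
    case True
    then show ?thesis
      using redheffer_on_arch[OF initial, of x] x by (simp add: field_simps)
  next
    case False
    obtain n where "x - a \<le> real n * a"
      using reals_Archimedean3[OF a] less_imp_le by blast
    then have "\<bar>S (x - a)\<bar> \<le> x - a" using abs_le[of "x - a" n] False by simp
    moreover have "S x = - S (x - a)"
      using S1[rule_format, of "x - a"] False by simp
    ultimately have "a - x \<le> S x" by simp
    \<comment> \<open>Cancelling \<open>a - x \<le> 0\<close>, the claim \<open>(a\<^sup>2 - x\<^sup>2) x \<le> (a - x) (a\<^sup>2 + x\<^sup>2)\<close> is just \<open>x \<ge> a\<close>.\<close>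
    have "0 \<le> (x - a) * (a * (x - a))" using False a by simp
    then have "(a\<^sup>2 - x\<^sup>2) * x \<le> (a - x) * (a\<^sup>2 + x\<^sup>2)"
      by (simp add: power2_eq_square algebra_simps)
    also have "\<dots> \<le> S x * (a\<^sup>2 + x\<^sup>2)"
      using \<open>a - x \<le> S x\<close> by (intro mult_right_mono) auto
    finally show ?thesis
      using x a by (simp add: divide_simps add_pos_pos)
  qed
  show ?thesis
  proof (intro allI impI)
    fix x :: real assume "x \<noteq> 0"
    show "(a\<^sup>2 - x\<^sup>2) / (a\<^sup>2 + x\<^sup>2) \<le> S x / x"
    proof (cases "0 < x")
      case False
      have "S x = - S (- x)" using S1[rule_format, of "- x"] False by simp
      then show ?thesis using pos[of "- x"] False \<open>x \<noteq> 0\<close> by simp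
    qed (rule pos)
  qed
qed

end
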